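(* Let $\psi=(\psi_1,\dots,\psi_n)^\top:[a,b]\times[0,T]\to\mathbb{C}^n$ be a (suitably regular) solution of the Manakov system $$\mathrm{i}\,\partial_t\psi_j=-\beta_j\,\partial_{xx}\psi_j-\sum_{k=1}^n\gamma_{jk}|\psi_k|^2\,\psi_j,\qquad j=1,\dots,n,\qquad (x,t)\in[a,b]\times[0,T],$$ with initial condition $\psi(x,0)=\psi^0(x)$, $x\in[a,b]$, and periodic boundary conditions in $x$ on $[a,b]$, where $\beta=\mathrm{diag}(\beta_1,\dots,\beta_n)\in\mathbb{R}^{n\times n}$ and $\gamma=(\gamma_{jk})=\gamma^\top\in\mathbb{R}^{n\times n}$. Then the following quantities are conserved (i.e. constant in $t\in[0,T]$): (mass of the $j$-th component) $\displaystyle M_j(t)=\int_a^b|\psi_j(x,t)|^2\,\mathrm{d}x$, $j=1,\dots,n$; (total mass) $\displaystyle M(t)=\sum_{j=1}^nM_j(t)$; (total momentum) $\displaystyle K(t)=\mathrm{Im}\langle\partial_x\psi,\psi\rangle=\frac{1}{2\mathrm{i}}\sum_{j=1}^n\int_a^b\left[\overline{\psi}_j(x,t)\,\partial_x\psi_j(x,t)-\psi_j(x,t)\,\partial_x\overline{\psi}_j(x,t)\right]\mathrm{d}x$; (energy) $\displaystyle E(t)=-\frac12\langle\beta\partial_{xx}\psi,\psi\rangle-\frac14\langle(\gamma|\psi|^2)\circ\psi,\psi\rangle=\frac12\sum_{j=1}^n\int_a^b\left[\beta_j|\partial_x\psi_j(x,t)|^2-\frac12\sum_{k=1}^n\ga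mma_{jk}|\psi_k(x,t)|^2|\psi_j(x,t)|^2\right]\mathrm{d}x$.
   Context: Here $\circ$ is the componentwise (Hadamard) product, $|\psi|^2=(|\psi_1|^2,\dots,|\psi_n|^2)^\top$, and $\langle\psi,\phi\rangle=\sum_{j=1}^n\int_a^b\psi_j(x)\overline{\phi_j(x)}\,\mathrm{d}x$. Standing assumption: $\psi^0$ is regular enough, as a periodic function, to ensure a correspondingly regular (periodic in space) solution $\psi$; $\psi$ and its $x$-derivatives are periodic in $x$ with period $b-a$, and $\psi$ is regular enough (for instance smooth) that all derivatives and integrals above make sense and one may integrate by parts in $x$, exchange partial derivatives, and differentiate under the integral sign. *)

theory Defs
  imports "HOL-Analysis.Analysis"
begin

text \<open>Functions of \<open>(x, t)\<close> on \<open>[a, b] \<times> [0, T]\<close> are curried. Derivatives are taken within the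
  closed intervals, so they are one-sided at the end points.\<close>

definition partial_x ::
  "real \<Rightarrow> real \<Rightarrow> (real \<Rightarrow> real \<Rightarrow> 'v::real_normed_vector) \<Rightarrow> real \<Rightarrow> real \<Rightarrow> 'v"
  where "partial_x a b f x t = vector_derivative (\<lambda>y. f y t) (at x within {a..b})"

definition partial_t ::
  "real \<Rightarrow> (real \<Rightarrow> real \<Rightarrow> 'v::real_normed_vector) \<Rightarrow> real \<Rightarrow> real \<Rightarrow> 'v"
  where "partial_t T f x t = vector_derivative (\<lambda>s. f x s) (at t within {0..T})"

abbreviation partial_xx ::
  "real \<Rightarrow> real \<Rightarrow> (real \<Rightarrow> real \<Rightarrow> 'v::real_normed_vector) \<Rightarrow> real \<Rightarrow> real \<Rightarrow> 'v"
  where "partial_xx a b f \<equiv> partial_x a b (partial_x a b f)"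

text \<open>The regularity class: \<open>f\<close>, \<open>f\<^sub>x\<close>, \<open>f\<^sub>x\<^sub>x\<close>, \<open>f\<^sub>t\<close> and \<open>f\<^sub>x\<^sub>t\<close> exist and are jointly continuous up to the
  boundary. Every smooth \<open>f\<close> belongs to it. The derivative \<open>f\<^sub>t\<^sub>x\<close> in the other order need not be
  listed: its existence and its equality with \<open>f\<^sub>x\<^sub>t\<close> follow.\<close>

definition regular ::
  "real \<Rightarrow> real \<Rightarrow> real \<Rightarrow> (real \<Rightarrow> real \<Rightarrow> 'v::real_normed_vector) \<Rightarrow> bool"
  where "regular a b T f \<longleftrightarrow>
    (\<forall>x\<in>{a..b}. \<forall>t\<in>{0..T}.
        (\<lambda>y. f y t) differentiable (at x within {a..b}) \<and>
        (\<lambda>y. partial_x a b f y t) differentiable (at x within {a..b}) \<and>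
        (\<lambda>s. f x s) differentiable (at t within {0..T}) \<and>
        (\<lambda>s. partial_x a b f x s) differentiable (at t within {0..T})) \<and>
    continuous_on ({a..b} \<times> {0..T}) (\<lambda>(x, t). f x t) \<and>
    continuous_on ({a..b} \<times> {0..T}) (\<lambda>(x, t). partial_x a b f x t) \<and>
    continuous_on ({a..b} \<times> {0..T}) (\<lambda>(x, t). partial_xx a b f x t) \<and>
    continuous_on ({a..b} \<times> {0..T}) (\<lambda>(x, t). partial_t T f x t) \<and>
    continuous_on ({a..b} \<times> {0..T}) (\<lambda>(x, t). partial_t T (partial_x a b f) x t)"

text \<open>Equivalently, for regular \<open>f\<close>: the \<open>(b - a)\<close>-periodic extension of \<open>f\<close> in \<open>x\<close> is of class
  \<open>C\<^sup>2\<close> in \<open>x\<close>.\<close>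

definition periodic_bc ::
  "real \<Rightarrow> real \<Rightarrow> real \<Rightarrow> (real \<Rightarrow> real \<Rightarrow> 'v::real_normed_vector) \<Rightarrow> bool"
  where "periodic_bc a b T f \<longleftrightarrow>
    (\<forall>t\<in>{0..T}. f a t = f b t \<and>
       partial_x a b f a t = partial_x a b f b t \<and>
       partial_xx a b f a t = partial_xx a b f b t)"

definition manakov ::
  "real \<Rightarrow> real \<Rightarrow> real \<Rightarrow> real^'n \<Rightarrow> real^'n^'n \<Rightarrow> (real \<Rightarrow> real \<Rightarrow> complex^'n::finite) \<Rightarrow> bool"
  where "manakov a b T \<beta> \<gamma> \<psi> \<longleftrightarrow>
    (\<forall>x\<in>{a..b}. \<forall>t\<in>{0..T}. \<forall>j.
       \<i> * partial_t T \<psi> x t $ j =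
         - of_real (\<beta> $ j) * partial_xx a b \<psi> x t $ j
         - (\<Sum>k\<in>UNIV. of_real (\<gamma> $ j $ k * (cmod (\<psi> x t $ k))\<^sup>2) * \<psi> x t $ j))"

definition diag :: "real^'n \<Rightarrow> real^'n^'n::finite"
  where "diag v = (\<chi> i j. if i = j then v $ i else 0)"

definition abs_square :: "complex^'n \<Rightarrow> real^'n::finite"
  where "abs_square u = (\<chi> j. (cmod (u $ j))\<^sup>2)"

definition complex_vec :: "real^'n \<Rightarrow> complex^'n::finite"
  where "complex_vec v = (\<chi> j. of_real (v $ j))"

definition L2_inner ::
  "real \<Rightarrow> real \<Rightarrow> (real \<Rightarrow> complex^'n::finite) \<Rightarrow> (real \<Rightarrow> complex^'n) \<Rightarrow> complex"
  where "L2_inner a b u v = (\<Sum>j\<in>UNIV. integral {a..b} (\<lambda>x. u x $ j * cnj (v x $ j)))"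

definition mass ::
  "real \<Rightarrow> real \<Rightarrow> (real \<Rightarrow> real \<Rightarrow> complex^'n::finite) \<Rightarrow> 'n \<Rightarrow> real \<Rightarrow> real"
  where "mass a b \<psi> j t = integral {a..b} (\<lambda>x. (cmod (\<psi> x t $ j))\<^sup>2)"

definition total_mass ::
  "real \<Rightarrow> real \<Rightarrow> (real \<Rightarrow> real \<Rightarrow> complex^'n::finite) \<Rightarrow> real \<Rightarrow> real"
  where "total_mass a b \<psi> t = (\<Sum>j\<in>UNIV. mass a b \<psi> j t)"

definition momentum ::
  "real \<Rightarrow> real \<Rightarrow> (real \<Rightarrow> real \<Rightarrow> complex^'n::finite) \<Rightarrow> real \<Rightarrow> real"
  where "momentum a b \<psi> t = Im (L2_inner a b (\<lambda>x. partial_x a b \<psi> x t) (\<lambda>x. \<psi> x t))"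

text \<open>The formula for the energy is a priori complex-valued. On \<^typ>\<open>complex^'n\<close> the product \<open>*\<close>
  is the componentwise (Hadamard) one.\<close>

definition energy ::
  "real \<Rightarrow> real \<Rightarrow> real^'n \<Rightarrow> real^'n^'n \<Rightarrow> (real \<Rightarrow> real \<Rightarrow> complex^'n::finite) \<Rightarrow> real \<Rightarrow> complex"
  where "energy a b \<beta> \<gamma> \<psi> t =
    - (1/2) * L2_inner a b (\<lambda>x. map_matrix of_real (diag \<beta>) *v partial_xx a b \<psi> x t) (\<lambda>x. \<psi> x t)
    - (1/4) * L2_inner a b (\<lambda>x. complex_vec (\<gamma> *v abs_square (\<psi> x t)) * \<psi> x t) (\<lambda>x. \<psi> x t)"

end

theory Submission
  imports Defs
begin

text \<open>
  Each of the three conserved quantities is the integral over a period of a real density \<open>\<rho>\<close> which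
  obeys a local conservation law \<open>\<rho>\<^sub>t = F\<^sub>x\<close> with a periodic flux \<open>F\<close>. Differentiation under the
  integral sign and the fundamental theorem of calculus then give
  \<open>d/dt \<integral> \<rho> = F(b, t) - F(a, t) = 0\<close>. With \<open>V\<^sub>j = \<Sum>\<^sub>k \<gamma>\<^sub>j\<^sub>k |u\<^sub>k|\<^sup>2\<close> the system reads
  \<open>u\<^sub>t = \<i> (\<beta> u\<^sub>x\<^sub>x + V u)\<close> in each component, and the densities and fluxes are

  \<^item> mass of component \<open>j\<close>: \<open>\<rho> = |u|\<^sup>2\<close> and \<open>F = - 2 \<beta> Im (u\<^sub>x cnj u)\<close>;

  \<^item> momentum: \<open>\<rho> = \<Sum>\<^sub>j Im (u\<^sub>x cnj u)\<close> and
    \<open>F = \<Sum>\<^sub>j (Im (u\<^sub>t cnj u) - \<beta> |u\<^sub>x|\<^sup>2) - 1/2 \<Sum>\<^sub>j V\<^sub>j |u\<^sub>j|\<^sup>2\<close>;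

  \<^item> energy: \<open>\<rho> = 1/2 \<Sum>\<^sub>j (\<beta> |u\<^sub>x|\<^sup>2 - 1/2 V\<^sub>j |u\<^sub>j|\<^sup>2)\<close> and \<open>F = \<Sum>\<^sub>j \<beta> Re (u\<^sub>x cnj u\<^sub>t)\<close>.

  Symmetry of \<open>\<gamma>\<close> enters the last two laws: for symmetric \<open>\<gamma>\<close> both factors of the quadratic form
  \<open>\<Sum>\<^sub>j V\<^sub>j |u\<^sub>j|\<^sup>2\<close> contribute equally to its derivative, which is therefore twice
  \<open>\<Sum>\<^sub>j V\<^sub>j (|u\<^sub>j|\<^sup>2)'\<close> (lemma \<open>has_real_derivative_symmetric_form\<close>). The fluxes that contain \<open>u\<^sub>t\<close> have to be differentiated in \<open>x\<close>, which requires
  \<open>u\<^sub>t\<^sub>x = u\<^sub>x\<^sub>t\<close> (lemma \<open>mixed_partial_derivatives\<close>).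

  The energy is defined through \<open>u\<^sub>x\<^sub>x cnj u\<close>, so its real form rests on one integration by parts
  (lemma \<open>integral_uxx_cnj_u\<close>).
\<close>

section \<open>Calculus on a rectangle\<close>

lemma continuous_on_slice:
  assumes "continuous_on (A \<times> B) (\<lambda>(x, t). f x t)" and "t \<in> B"
  shows "continuous_on A (\<lambda>x. f x t)"
  using continuous_on_compose2[OF assms(1), of A "\<lambda>x. (x, t)"] assms(2)
  by (auto simp: continuous_on_Pair)

lemma continuous_on_swap_args:
  assumes "continuous_on (A \<times> B) (\<lambda>(x, t). f x t)"
  shows "continuous_on (B \<times> A) (\<lambda>(t, x). f x t)"
proof -
  have "continuous_on (B \<times> A) (\<lambda>z. (\<lambda>(x, t). f x t) (snd z, fst z))"
    by (rule continuous_on_compose2[OF assms]) (auto intro!: continuous_intros)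
  then show ?thesis by (simp add: split_def)
qed

lemma integral_has_vector_derivative_parameter:
  fixes f f' :: "real \<Rightarrow> real \<Rightarrow> 'v::banach"
  assumes deriv: "\<And>x t. x \<in> {a..b} \<Longrightarrow> t \<in> {c..d} \<Longrightarrow>
      ((\<lambda>s. f x s) has_vector_derivative f' x t) (at t within {c..d})"
    and cont_f: "continuous_on ({a..b} \<times> {c..d}) (\<lambda>(x, t). f x t)"
    and cont_f': "continuous_on ({a..b} \<times> {c..d}) (\<lambda>(x, t). f' x t)"
    and t: "t \<in> {c..d}"
  shows "((\<lambda>s. integral {a..b} (\<lambda>x. f x s)) has_vector_derivative
    integral {a..b} (\<lambda>x. f' x t)) (at t within {c..d})"
proof -
  have "((\<lambda>s. integral (cbox a b) (\<lambda>x. f x s)) has_vector_derivative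
      integral (cbox a b) (\<lambda>x. f' x t)) (at t within {c..d})"
  proof (rule leibniz_rule_vector_derivative)
    show "((\<lambda>s. f x s) has_vector_derivative f' x s) (at s within {c..d})"
      if "s \<in> {c..d}" "x \<in> cbox a b" for s x
      using deriv that by simp
    show "(\<lambda>x. f x s) integrable_on cbox a b" if "s \<in> {c..d}" for s
      using continuous_on_slice[OF cont_f that] by (simp add: integrable_continuous_real)
    show "continuous_on ({c..d} \<times> cbox a b) (\<lambda>(s, x). f' x s)"
      using continuous_on_swap_args[OF cont_f'] by simp
  qed (use t in auto)
  then show ?thesis by simp
qed

text \<open>Write \<open>f(y, s) - f(a, s)\<close> as \<open>\<integral>\<^sub>a\<^sup>y f\<^sub>x(z, s) dz\<close> and differentiate in \<open>s\<close> under the integral: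
  \<open>f\<^sub>t(y, t) - f\<^sub>t(a, t)\<close> is an indefinite integral of the continuous function \<open>f\<^sub>x\<^sub>t\<close>. The
  existence of \<open>f\<^sub>t\<^sub>x\<close> comes out together with its value.\<close>

lemma mixed_partial_derivatives:
  fixes f fx ft fxt :: "real \<Rightarrow> real \<Rightarrow> 'v::banach"
  assumes "c < d"
    and fx: "\<And>x t. x \<in> {a..b} \<Longrightarrow> t \<in> {c..d} \<Longrightarrow>
      ((\<lambda>y. f y t) has_vector_derivative fx x t) (at x within {a..b})"
    and ft: "\<And>x t. x \<in> {a..b} \<Longrightarrow> t \<in> {c..d} \<Longrightarrow>
      ((\<lambda>s. f x s) has_vector_derivative ft x t) (at t within {c..d})"
    and fxt: "\<And>x t. x \<in> {a..b} \<Longrightarrow> t \<in> {c..d} \<Longrightarrow>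
      ((\<lambda>s. fx x s) has_vector_derivative fxt x t) (at t within {c..d})"
    and cont_fx: "continuous_on ({a..b} \<times> {c..d}) (\<lambda>(x, t). fx x t)"
    and cont_fxt: "continuous_on ({a..b} \<times> {c..d}) (\<lambda>(x, t). fxt x t)"
    and x: "x \<in> {a..b}" and t: "t \<in> {c..d}"
  shows "((\<lambda>y. ft y t) has_vector_derivative fxt x t) (at x within {a..b})"
proof -
  have ft_eq: "ft y t = ft a t + integral {a..y} (\<lambda>z. fxt z t)" if y: "y \<in> {a..b}" for y
  proof -
    have sub: "{a..y} \<times> {c..d} \<subseteq> {a..b} \<times> {c..d}" using y by auto
    have ftc: "integral {a..y} (\<lambda>z. fx z s) = f y s - f a s" if s: "s \<in> {c..d}" for s
    proof (rule integral_unique, rule fundamental_theorem_of_calculus)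
      show "((\<lambda>y. f y s) has_vector_derivative fx z s) (at z within {a..y})" if "z \<in> {a..y}" for z
        by (rule has_vector_derivative_within_subset[OF fx]) (use that y s in auto)
    qed (use y in auto)
    have "((\<lambda>s. integral {a..y} (\<lambda>z. fx z s)) has_vector_derivative
        integral {a..y} (\<lambda>z. fxt z t)) (at t within {c..d})"
      by (rule integral_has_vector_derivative_parameter)
        (use y t in \<open>auto intro!: fxt continuous_on_subset[OF cont_fx sub]
           continuous_on_subset[OF cont_fxt sub]\<close>)
    then have "((\<lambda>s. f y s - f a s) has_vector_derivative
        integral {a..y} (\<lambda>z. fxt z t)) (at t within {c..d})"
      by (rule has_vector_derivative_transform[rotated 2]) (use t ftc in auto)
    moreover have "((\<lambda>s. f y s - f a s) has_vector_derivative ft y t - ft a t) (at t within {c..d})"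
      using y t by (intro has_vector_derivative_diff ft) auto
    ultimately have "integral {a..y} (\<lambda>z. fxt z t) = ft y t - ft a t"
      by (rule vector_derivative_unique_within[rotated])
        (use \<open>c < d\<close> t in \<open>simp add: trivial_limit_within islimpt_Icc\<close>)
    then show ?thesis by simp
  qed
  have "((\<lambda>y. integral {a..y} (\<lambda>z. fxt z t)) has_vector_derivative fxt x t) (at x within {a..b})"
    by (rule integral_has_vector_derivative[OF continuous_on_slice[OF cont_fxt t] x])
  then have "((\<lambda>y. ft a t + integral {a..y} (\<lambda>z. fxt z t)) has_vector_derivative fxt x t)
      (at x within {a..b})"
    by (auto intro!: derivative_eq_intros)
  then show ?thesis
    by (rule has_vector_derivative_transform[OF x, rotated]) (rule ft_eq)
qed

lemma integral_constant_if_conservation_law: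
  fixes \<rho> \<rho>t F :: "real \<Rightarrow> real \<Rightarrow> real"
  assumes "a \<le> b"
    and \<rho>t: "\<And>x t. x \<in> {a..b} \<Longrightarrow> t \<in> {0..T} \<Longrightarrow>
      ((\<lambda>s. \<rho> x s) has_real_derivative \<rho>t x t) (at t within {0..T})"
    and cont: "continuous_on ({a..b} \<times> {0..T}) (\<lambda>(x, t). \<rho> x t)"
      "continuous_on ({a..b} \<times> {0..T}) (\<lambda>(x, t). \<rho>t x t)"
    and flux: "\<And>x t. x \<in> {a..b} \<Longrightarrow> t \<in> {0..T} \<Longrightarrow>
      ((\<lambda>y. F y t) has_real_derivative \<rho>t x t) (at x within {a..b})"
    and periodic: "\<And>t. t \<in> {0..T} \<Longrightarrow> F a t = F b t"
  shows "(\<lambda>t. integral {a..b} (\<lambda>x. \<rho> x t)) constant_on {0..T}"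
proof -
  have "((\<lambda>s. integral {a..b} (\<lambda>x. \<rho> x s)) has_vector_derivative 0) (at t within {0..T})"
    if t: "t \<in> {0..T}" for t
  proof -
    have "((\<lambda>x. \<rho>t x t) has_integral F b t - F a t) {a..b}"
      by (rule fundamental_theorem_of_calculus[OF \<open>a \<le> b\<close>])
        (use flux t in \<open>simp add: has_real_derivative_iff_has_vector_derivative\<close>)
    then have "integral {a..b} (\<lambda>x. \<rho>t x t) = 0"
      using periodic[OF t] by (simp add: integral_unique)
    then show ?thesis
      using integral_has_vector_derivative_parameter[of a b 0 T \<rho> \<rho>t t] \<rho>t cont t
      by (simp add: has_real_derivative_iff_has_vector_derivative)
  qed
  then obtain c where "\<And>t. t \<in> {0..T} \<Longrightarrow> integral {a..b} (\<lambda>x. \<rho> x t) = c"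
    using has_vector_derivative_zero_constant[of "{0..T}" "\<lambda>t. integral {a..b} (\<lambda>x. \<rho> x t)"]
    by auto
  then show ?thesis unfolding constant_on_def by blast
qed

lemma has_vector_derivative_mult_cnj:
  assumes "(f has_vector_derivative f') (at x within S)"
    and "(g has_vector_derivative g') (at x within S)"
  shows "((\<lambda>y. f y * cnj (g y)) has_vector_derivative f' * cnj (g x) + f x * cnj g') (at x within S)"
  using has_vector_derivative_mult[OF assms(1)
      bounded_linear.has_vector_derivative[OF bounded_linear_cnj assms(2)]]
  by (simp add: add.commute)

lemma has_real_derivative_Re_mult_cnj:
  assumes "(f has_vector_derivative f') (at x within S)"
    and "(g has_vector_derivative g') (at x within S)"
  shows "((\<lambda>y. Re (f y * cnj (g y))) has_real_derivative Re (f' * cnj (g x) + f x * cnj g'))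
    (at x within S)"
  using bounded_linear.has_vector_derivative[OF bounded_linear_Re has_vector_derivative_mult_cnj[OF assms]]
  by (simp add: has_real_derivative_iff_has_vector_derivative)

lemma has_real_derivative_Im_mult_cnj:
  assumes "(f has_vector_derivative f') (at x within S)"
    and "(g has_vector_derivative g') (at x within S)"
  shows "((\<lambda>y. Im (f y * cnj (g y))) has_real_derivative Im (f' * cnj (g x) + f x * cnj g'))
    (at x within S)"
  using bounded_linear.has_vector_derivative[OF bounded_linear_Im has_vector_derivative_mult_cnj[OF assms]]
  by (simp add: has_real_derivative_iff_has_vector_derivative)

lemma has_real_derivative_cmod_square:
  assumes "(f has_vector_derivative f') (at x within S)"
  shows "((\<lambda>y. (cmod (f y))\<^sup>2) has_real_derivative 2 * Re (f' * cnj (f x))) (at x within S)"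
proof -
  have "(\<lambda>y. (cmod (f y))\<^sup>2) = (\<lambda>y. Re (f y * cnj (f y)))"
    by (simp add: cmod_power2 complex_mult_cnj)
  moreover have "Re (f' * cnj (f x) + f x * cnj f') = 2 * Re (f' * cnj (f x))"
    by (simp add: algebra_simps)
  ultimately show ?thesis
    using has_real_derivative_Re_mult_cnj[OF assms assms] by simp
qed

lemma has_real_derivative_symmetric_form:
  fixes \<gamma> :: "'n::finite \<Rightarrow> 'n \<Rightarrow> real"
  assumes w: "\<And>j. ((\<lambda>y. w j y) has_real_derivative w' j) (at x within S)"
    and sym: "\<And>j k. \<gamma> j k = \<gamma> k j"
  shows "((\<lambda>y. \<Sum>j\<in>UNIV. (\<Sum>k\<in>UNIV. \<gamma> j k * w k y) * w j y) has_real_derivative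
    2 * (\<Sum>j\<in>UNIV. (\<Sum>k\<in>UNIV. \<gamma> j k * w k x) * w' j)) (at x within S)"
proof -
  have "(\<Sum>j\<in>UNIV. (\<Sum>k\<in>UNIV. \<gamma> j k * w' k) * w j x) =
      (\<Sum>j\<in>UNIV. \<Sum>k\<in>UNIV. \<gamma> j k * w' k * w j x)"
    by (simp add: sum_distrib_right)
  also have "\<dots> = (\<Sum>k\<in>UNIV. \<Sum>j\<in>UNIV. \<gamma> j k * w' k * w j x)"
    by (rule sum.swap)
  also have "\<dots> = (\<Sum>k\<in>UNIV. \<Sum>j\<in>UNIV. \<gamma> k j * w j x * w' k)"
    by (intro sum.cong refl) (simp add: sym mult_ac)
  finally have swap: "(\<Sum>j\<in>UNIV. (\<Sum>k\<in>UNIV. \<gamma> j k * w' k) * w j x) =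
      (\<Sum>j\<in>UNIV. (\<Sum>k\<in>UNIV. \<gamma> j k * w k x) * w' j)"
    by (simp add: sum_distrib_right)
  have "((\<lambda>y. \<Sum>j\<in>UNIV. (\<Sum>k\<in>UNIV. \<gamma> j k * w k y) * w j y) has_real_derivative
    (\<Sum>j\<in>UNIV. (\<Sum>k\<in>UNIV. \<gamma> j k * w k x) * w' j + (\<Sum>k\<in>UNIV. \<gamma> j k * w' k) * w j x))
    (at x within S)"
    by (intro DERIV_sum DERIV_mult' DERIV_cmult w)
  then show ?thesis
    by (simp add: sum.distrib swap)
qed

lemma henstock_integral_complex_of_real:
  assumes "f integrable_on S"
  shows "integral S (\<lambda>x. complex_of_real (f x)) = of_real (integral S f)"
  using integral_linear[OF assms bounded_linear_of_real] by (simp add: o_def)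

section \<open>Conservation laws for the components of a solution\<close>

text \<open>The partial derivatives are parameters, so that the components of a vector-valued derivative
  can be used for them directly.\<close>

locale manakov_components =
  fixes a b T :: real
    and \<beta> :: "'n::finite \<Rightarrow> real" and \<gamma> :: "'n \<Rightarrow> 'n \<Rightarrow> real"
    and u ux uxx ut uxt :: "'n \<Rightarrow> real \<Rightarrow> real \<Rightarrow> complex"
  assumes ab: "a < b" and T: "0 < T"
    and \<gamma>_sym: "\<gamma> j k = \<gamma> k j"
    and deriv_u_x: "x \<in> {a..b} \<Longrightarrow> t \<in> {0..T} \<Longrightarrow>
      ((\<lambda>y. u j y t) has_vector_derivative ux j x t) (at x within {a..b})"
    and deriv_ux_x: "x \<in> {a..b} \<Longrightarrow> t \<in> {0..T} \<Longrightarrow>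
      ((\<lambda>y. ux j y t) has_vector_derivative uxx j x t) (at x within {a..b})"
    and deriv_u_t: "x \<in> {a..b} \<Longrightarrow> t \<in> {0..T} \<Longrightarrow>
      ((\<lambda>s. u j x s) has_vector_derivative ut j x t) (at t within {0..T})"
    and deriv_ux_t: "x \<in> {a..b} \<Longrightarrow> t \<in> {0..T} \<Longrightarrow>
      ((\<lambda>s. ux j x s) has_vector_derivative uxt j x t) (at t within {0..T})"
    and cont_u: "continuous_on ({a..b} \<times> {0..T}) (\<lambda>(x, t). u j x t)"
    and cont_ux: "continuous_on ({a..b} \<times> {0..T}) (\<lambda>(x, t). ux j x t)"
    and cont_uxx: "continuous_on ({a..b} \<times> {0..T}) (\<lambda>(x, t). uxx j x t)"
    and cont_ut: "continuous_on ({a..b} \<times> {0..T}) (\<lambda>(x, t). ut j x t)"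
    and cont_uxt: "continuous_on ({a..b} \<times> {0..T}) (\<lambda>(x, t). uxt j x t)"
    and u_periodic: "t \<in> {0..T} \<Longrightarrow> u j a t = u j b t"
    and ux_periodic: "t \<in> {0..T} \<Longrightarrow> ux j a t = ux j b t"
    and equation: "x \<in> {a..b} \<Longrightarrow> t \<in> {0..T} \<Longrightarrow>
      \<i> * ut j x t = - of_real (\<beta> j) * uxx j x t
        - (\<Sum>k\<in>UNIV. of_real (\<gamma> j k * (cmod (u k x t))\<^sup>2) * u j x t)"
begin

definition potential :: "'n \<Rightarrow> real \<Rightarrow> real \<Rightarrow> real"
  where "potential j x t = (\<Sum>k\<in>UNIV. \<gamma> j k * (cmod (u k x t))\<^sup>2)"

lemma ut_eq:
  assumes "x \<in> {a..b}" "t \<in> {0..T}"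
  shows "ut j x t = \<i> * (of_real (\<beta> j) * uxx j x t + of_real (potential j x t) * u j x t)"
proof -
  have "ut j x t = - \<i> * (\<i> * ut j x t)" by (simp flip: mult.assoc)
  also have "\<i> * ut j x t = - (of_real (\<beta> j) * uxx j x t + of_real (potential j x t) * u j x t)"
    using equation[OF assms, of j] by (simp add: potential_def sum_distrib_right)
  finally show ?thesis by (simp only: minus_mult_minus)
qed

text \<open>The function \<open>u\<^sub>t\<close> occurs in the fluxes of momentum and energy.\<close>

lemma deriv_ut_x:
  assumes "x \<in> {a..b}" "t \<in> {0..T}"
  shows "((\<lambda>y. ut j y t) has_vector_derivative uxt j x t) (at x within {a..b})"
proof (rule mixed_partial_derivatives[where f = "u j" and fx = "ux j",
      OF T _ _ _ cont_ux cont_uxt assms])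
  fix x t assume xt: "x \<in> {a..b}" "t \<in> {0..T}"
  show "((\<lambda>y. u j y t) has_vector_derivative ux j x t) (at x within {a..b})"
    by (rule deriv_u_x[OF xt])
  show "((\<lambda>s. u j x s) has_vector_derivative ut j x t) (at t within {0..T})"
    by (rule deriv_u_t[OF xt])
  show "((\<lambda>s. ux j x s) has_vector_derivative uxt j x t) (at t within {0..T})"
    by (rule deriv_ux_t[OF xt])
qed

lemma ut_periodic:
  assumes t: "t \<in> {0..T}"
  shows "ut j a t = ut j b t"
proof -
  have mem: "a \<in> {a..b}" "b \<in> {a..b}" using ab by auto
  have "((\<lambda>s. u j a s) has_vector_derivative ut j b t) (at t within {0..T})"
  proof (rule has_vector_derivative_transform)
    show "((\<lambda>s. u j b s) has_vector_derivative ut j b t) (at t within {0..T})"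
      by (rule deriv_u_t[OF mem(2) t])
    show "u j a s = u j b s" if "s \<in> {0..T}" for s
      by (rule u_periodic[OF that])
  qed (rule t)
  then show ?thesis
    using vector_derivative_unique_within_closed_interval[of 0 T t "\<lambda>s. u j a s" "ut j a t" "ut j b t"]
      T t deriv_u_t[OF mem(1) t, of j] by simp
qed

lemmas joint_continuity =
  cont_u[unfolded split_def] cont_ux[unfolded split_def] cont_ut[unfolded split_def]
  cont_uxt[unfolded split_def]

text \<open>The potential is real, so \<open>\<i> V |u|\<^sup>2\<close> drops out of \<open>\<rho>\<^sub>t = 2 Re (u\<^sub>t cnj u)\<close>. What remains is
  \<open>- 2 \<beta> Im (u\<^sub>x\<^sub>x cnj u)\<close>, the derivative of the flux because \<open>|u\<^sub>x|\<^sup>2\<close> is real.\<close>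

lemma mass_conserved: "(\<lambda>t. integral {a..b} (\<lambda>x. (cmod (u j x t))\<^sup>2)) constant_on {0..T}"
proof (rule integral_constant_if_conservation_law
    [where \<rho>t = "\<lambda>x t. 2 * Re (ut j x t * cnj (u j x t))"
      and F = "\<lambda>x t. - 2 * \<beta> j * Im (ux j x t * cnj (u j x t))"])
  fix x t assume xt: "x \<in> {a..b}" "t \<in> {0..T}"
  show "((\<lambda>s. (cmod (u j x s))\<^sup>2) has_real_derivative 2 * Re (ut j x t * cnj (u j x t)))
      (at t within {0..T})"
    by (intro has_real_derivative_cmod_square deriv_u_t xt)
  have "((\<lambda>y. - 2 * \<beta> j * Im (ux j y t * cnj (u j y t))) has_real_derivative
      - 2 * \<beta> j * Im (uxx j x t * cnj (u j x t) + ux j x t * cnj (ux j x t))) (at x within {a..b})"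
    by (intro DERIV_cmult has_real_derivative_Im_mult_cnj deriv_u_x deriv_ux_x xt)
  moreover have "- 2 * \<beta> j * Im (uxx j x t * cnj (u j x t) + ux j x t * cnj (ux j x t)) =
      2 * Re (ut j x t * cnj (u j x t))"
    by (simp add: ut_eq[OF xt] algebra_simps)
  ultimately show "((\<lambda>y. - 2 * \<beta> j * Im (ux j y t * cnj (u j y t))) has_real_derivative
      2 * Re (ut j x t * cnj (u j x t))) (at x within {a..b})"
    by simp
next
  show "continuous_on ({a..b} \<times> {0..T}) (\<lambda>(x, t). (cmod (u j x t))\<^sup>2)"
    unfolding split_def by (intro joint_continuity continuous_intros)
  show "continuous_on ({a..b} \<times> {0..T}) (\<lambda>(x, t). 2 * Re (ut j x t * cnj (u j x t)))"
    unfolding split_def by (intro joint_continuity continuous_intros)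
qed (use ab in \<open>simp_all add: u_periodic ux_periodic\<close>)

text \<open>The derivative \<open>Im (u\<^sub>x\<^sub>t cnj u + u\<^sub>x cnj u\<^sub>t)\<close> of the density differs from \<open>(Im (u\<^sub>t cnj u))\<^sub>x\<close> by
  \<open>2 Im (u\<^sub>x cnj u\<^sub>t)\<close>. By the equation this equals
  \<open>- 2 Re (u\<^sub>x (\<beta> cnj u\<^sub>x\<^sub>x + V cnj u)) = - \<beta> (|u\<^sub>x|\<^sup>2)\<^sub>x - V (|u|\<^sup>2)\<^sub>x\<close>. The last term becomes an
  \<open>x\<close>-derivative only after summation over the components.\<close>

lemma momentum_conserved:
  "(\<lambda>t. integral {a..b} (\<lambda>x. \<Sum>j\<in>UNIV. Im (ux j x t * cnj (u j x t)))) constant_on {0..T}"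
proof (rule integral_constant_if_conservation_law
    [where \<rho>t = "\<lambda>x t. \<Sum>j\<in>UNIV. Im (uxt j x t * cnj (u j x t) + ux j x t * cnj (ut j x t))"
      and F = "\<lambda>x t. (\<Sum>j\<in>UNIV. Im (ut j x t * cnj (u j x t)) - \<beta> j * (cmod (ux j x t))\<^sup>2)
        - 1/2 * (\<Sum>j\<in>UNIV. potential j x t * (cmod (u j x t))\<^sup>2)"])
  fix x t assume xt: "x \<in> {a..b}" "t \<in> {0..T}"
  show "((\<lambda>s. \<Sum>j\<in>UNIV. Im (ux j x s * cnj (u j x s))) has_real_derivative
      (\<Sum>j\<in>UNIV. Im (uxt j x t * cnj (u j x t) + ux j x t * cnj (ut j x t)))) (at t within {0..T})"
    by (intro DERIV_sum has_real_derivative_Im_mult_cnj deriv_u_t deriv_ux_t xt)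
  have "((\<lambda>y. (\<Sum>j\<in>UNIV. Im (ut j y t * cnj (u j y t)) - \<beta> j * (cmod (ux j y t))\<^sup>2)
        - 1/2 * (\<Sum>j\<in>UNIV. potential j y t * (cmod (u j y t))\<^sup>2)) has_real_derivative
      (\<Sum>j\<in>UNIV. Im (uxt j x t * cnj (u j x t) + ut j x t * cnj (ux j x t))
          - \<beta> j * (2 * Re (uxx j x t * cnj (ux j x t))))
        - 1/2 * (2 * (\<Sum>j\<in>UNIV. potential j x t * (2 * Re (ux j x t * cnj (u j x t))))))
      (at x within {a..b})"
    unfolding potential_def
    by (intro DERIV_sum DERIV_diff DERIV_cmult has_real_derivative_Im_mult_cnj
        has_real_derivative_symmetric_form has_real_derivative_cmod_square
        deriv_u_x deriv_ux_x deriv_ut_x xt \<gamma>_sym)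
  moreover have "(\<Sum>j\<in>UNIV. Im (uxt j x t * cnj (u j x t) + ut j x t * cnj (ux j x t))
          - \<beta> j * (2 * Re (uxx j x t * cnj (ux j x t))))
        - 1/2 * (2 * (\<Sum>j\<in>UNIV. potential j x t * (2 * Re (ux j x t * cnj (u j x t))))) =
      (\<Sum>j\<in>UNIV. Im (uxt j x t * cnj (u j x t) + ux j x t * cnj (ut j x t)))"
    by (simp add: sum_subtractf[symmetric] ut_eq[OF xt] algebra_simps del: sum_subtractf)
  ultimately show "((\<lambda>y. (\<Sum>j\<in>UNIV. Im (ut j y t * cnj (u j y t)) - \<beta> j * (cmod (ux j y t))\<^sup>2)
        - 1/2 * (\<Sum>j\<in>UNIV. potential j y t * (cmod (u j y t))\<^sup>2)) has_real_derivative
      (\<Sum>j\<in>UNIV. Im (uxt j x t * cnj (u j x t) + ux j x t * cnj (ut j x t)))) (at x within {a..b})"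
    by simp
next
  show "continuous_on ({a..b} \<times> {0..T}) (\<lambda>(x, t). \<Sum>j\<in>UNIV. Im (ux j x t * cnj (u j x t)))"
    unfolding split_def by (intro joint_continuity continuous_intros)
  show "continuous_on ({a..b} \<times> {0..T}) (\<lambda>(x, t). \<Sum>j\<in>UNIV.
      Im (uxt j x t * cnj (u j x t) + ux j x t * cnj (ut j x t)))"
    unfolding split_def by (intro joint_continuity continuous_intros)
qed (use ab in \<open>simp_all add: u_periodic ux_periodic ut_periodic potential_def\<close>)

text \<open>The derivative of the density is \<open>\<Sum>\<^sub>j (\<beta> Re (u\<^sub>x\<^sub>t cnj u\<^sub>x) - V Re (u\<^sub>t cnj u))\<close>. Moving an
  \<open>x\<close>-derivative in its first term from \<open>u\<^sub>x\<^sub>t = u\<^sub>t\<^sub>x\<close> to \<open>u\<^sub>x\<close> leaves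
  \<open>- Re ((\<beta> u\<^sub>x\<^sub>x + V u) cnj u\<^sub>t)\<close>, which vanishes by the equation.\<close>

lemma energy_conserved:
  "(\<lambda>t. integral {a..b} (\<lambda>x. (\<Sum>j\<in>UNIV. 1/2 * (\<beta> j * (cmod (ux j x t))\<^sup>2))
      - 1/4 * (\<Sum>j\<in>UNIV. potential j x t * (cmod (u j x t))\<^sup>2))) constant_on {0..T}"
proof (rule integral_constant_if_conservation_law
    [where \<rho>t = "\<lambda>x t. (\<Sum>j\<in>UNIV. 1/2 * (\<beta> j * (2 * Re (uxt j x t * cnj (ux j x t)))))
        - 1/4 * (2 * (\<Sum>j\<in>UNIV. potential j x t * (2 * Re (ut j x t * cnj (u j x t)))))"
      and F = "\<lambda>x t. \<Sum>j\<in>UNIV. \<beta> j * Re (ux j x t * cnj (ut j x t))"])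
  fix x t assume xt: "x \<in> {a..b}" "t \<in> {0..T}"
  show "((\<lambda>s. (\<Sum>j\<in>UNIV. 1/2 * (\<beta> j * (cmod (ux j x s))\<^sup>2))
        - 1/4 * (\<Sum>j\<in>UNIV. potential j x s * (cmod (u j x s))\<^sup>2)) has_real_derivative
      (\<Sum>j\<in>UNIV. 1/2 * (\<beta> j * (2 * Re (uxt j x t * cnj (ux j x t)))))
        - 1/4 * (2 * (\<Sum>j\<in>UNIV. potential j x t * (2 * Re (ut j x t * cnj (u j x t))))))
      (at t within {0..T})"
    unfolding potential_def
    by (intro DERIV_sum DERIV_diff DERIV_cmult has_real_derivative_symmetric_form
        has_real_derivative_cmod_square deriv_u_t deriv_ux_t xt \<gamma>_sym)
  have "((\<lambda>y. \<Sum>j\<in>UNIV. \<beta> j * Re (ux j y t * cnj (ut j y t))) has_real_derivative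
      (\<Sum>j\<in>UNIV. \<beta> j * Re (uxx j x t * cnj (ut j x t) + ux j x t * cnj (uxt j x t))))
      (at x within {a..b})"
    by (intro DERIV_sum DERIV_cmult has_real_derivative_Re_mult_cnj deriv_ux_x deriv_ut_x xt)
  moreover have "\<beta> j * Re (uxx j x t * cnj (ut j x t) + ux j x t * cnj (uxt j x t)) =
      1/2 * (\<beta> j * (2 * Re (uxt j x t * cnj (ux j x t))))
        - 1/4 * (2 * (potential j x t * (2 * Re (ut j x t * cnj (u j x t)))))" for j
  proof -
    \<comment> \<open>Since \<open>\<beta> u\<^sub>x\<^sub>x + V u = - \<i> u\<^sub>t\<close>, the left-hand side is \<open>Re (- \<i> |u\<^sub>t|\<^sup>2)\<close>.\<close>
    have "\<beta> j * Re (uxx j x t * cnj (ut j x t)) + potential j x t * Re (ut j x t * cnj (u j x t)) = 0"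
      by (simp add: ut_eq[OF xt] algebra_simps)
    then show ?thesis by (simp add: algebra_simps)
  qed
  ultimately show "((\<lambda>y. \<Sum>j\<in>UNIV. \<beta> j * Re (ux j y t * cnj (ut j y t))) has_real_derivative
      (\<Sum>j\<in>UNIV. 1/2 * (\<beta> j * (2 * Re (uxt j x t * cnj (ux j x t)))))
        - 1/4 * (2 * (\<Sum>j\<in>UNIV. potential j x t * (2 * Re (ut j x t * cnj (u j x t))))))
      (at x within {a..b})"
    by (simp only: sum_subtractf sum_distrib_left)
next
  show "continuous_on ({a..b} \<times> {0..T}) (\<lambda>(x, t). (\<Sum>j\<in>UNIV. 1/2 * (\<beta> j * (cmod (ux j x t))\<^sup>2))
      - 1/4 * (\<Sum>j\<in>UNIV. potential j x t * (cmod (u j x t))\<^sup>2))"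
    unfolding split_def potential_def by (intro joint_continuity continuous_intros)
  show "continuous_on ({a..b} \<times> {0..T}) (\<lambda>(x, t). (\<Sum>j\<in>UNIV. 1/2 * (\<beta> j * (2 * Re (uxt j x t * cnj (ux j x t)))))
      - 1/4 * (2 * (\<Sum>j\<in>UNIV. potential j x t * (2 * Re (ut j x t * cnj (u j x t))))))"
    unfolding split_def potential_def by (intro joint_continuity continuous_intros)
qed (use ab in \<open>simp_all add: u_periodic ux_periodic ut_periodic\<close>)

section \<open>The integral formulas for momentum and energy\<close>

lemma slice_continuity:
  assumes "t \<in> {0..T}"
  shows "continuous_on {a..b} (\<lambda>x. u j x t)" and "continuous_on {a..b} (\<lambda>x. ux j x t)"
    and "continuous_on {a..b} (\<lambda>x. uxx j x t)"
  by (rule continuous_on_slice[OF cont_u assms] continuous_on_slice[OF cont_ux assms]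
      continuous_on_slice[OF cont_uxx assms])+

lemma Im_sum_integral_ux_cnj_u:
  assumes t: "t \<in> {0..T}"
  shows "Im (\<Sum>j\<in>UNIV. integral {a..b} (\<lambda>x. ux j x t * cnj (u j x t))) =
    integral {a..b} (\<lambda>x. \<Sum>j\<in>UNIV. Im (ux j x t * cnj (u j x t)))"
proof -
  have "Im (integral {a..b} (\<lambda>x. ux j x t * cnj (u j x t))) =
      integral {a..b} (\<lambda>x. Im (ux j x t * cnj (u j x t)))" for j
    using integral_linear[OF _ bounded_linear_Im, of "\<lambda>x. ux j x t * cnj (u j x t)" "{a..b}"]
    by (simp only: o_def integrable_continuous_real continuous_intros slice_continuity[OF t])
  moreover have "integral {a..b} (\<lambda>x. \<Sum>j\<in>UNIV. Im (ux j x t * cnj (u j x t))) =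
      (\<Sum>j\<in>UNIV. integral {a..b} (\<lambda>x. Im (ux j x t * cnj (u j x t))))"
    by (intro integral_sum integrable_continuous_real slice_continuity[OF t] continuous_intros) simp
  ultimately show ?thesis by (simp only: Im_sum)
qed

lemma sum_integral_antisymmetrized_eq:
  assumes t: "t \<in> {0..T}"
  shows "1 / (2 * \<i>) * (\<Sum>j\<in>UNIV. integral {a..b} (\<lambda>x.
      cnj (u j x t) * ux j x t - u j x t * cnj (ux j x t))) =
    of_real (integral {a..b} (\<lambda>x. \<Sum>j\<in>UNIV. Im (ux j x t * cnj (u j x t))))"
proof -
  have pointwise: "cnj (u j x t) * ux j x t - u j x t * cnj (ux j x t) =
      2 * \<i> * of_real (Im (ux j x t * cnj (u j x t)))" for j x
    by (simp add: complex_eq_iff algebra_simps)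
  have integrable: "(\<lambda>x. Im (ux j x t * cnj (u j x t))) integrable_on {a..b}" for j
    by (intro integrable_continuous_real slice_continuity[OF t] continuous_intros)
  have "integral {a..b} (\<lambda>x. cnj (u j x t) * ux j x t - u j x t * cnj (ux j x t)) =
      2 * \<i> * of_real (integral {a..b} (\<lambda>x. Im (ux j x t * cnj (u j x t))))" for j
    unfolding pointwise integral_mult_right henstock_integral_complex_of_real[OF integrable] ..
  moreover have "integral {a..b} (\<lambda>x. \<Sum>j\<in>UNIV. Im (ux j x t * cnj (u j x t))) =
      (\<Sum>j\<in>UNIV. integral {a..b} (\<lambda>x. Im (ux j x t * cnj (u j x t))))"
    by (rule integral_sum) (use integrable in auto)
  ultimately show ?thesis
    by (simp only: sum_distrib_left[symmetric] of_real_sum) simp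
qed

text \<open>The function \<open>u\<^sub>x\<^sub>x cnj u + |u\<^sub>x|\<^sup>2\<close> is the \<open>x\<close>-derivative of the periodic function \<open>u\<^sub>x cnj u\<close>.\<close>

lemma integral_uxx_cnj_u:
  assumes t: "t \<in> {0..T}"
  shows "integral {a..b} (\<lambda>x. uxx j x t * cnj (u j x t)) =
    - of_real (integral {a..b} (\<lambda>x. (cmod (ux j x t))\<^sup>2))"
proof -
  have "((\<lambda>x. uxx j x t * cnj (u j x t) + ux j x t * cnj (ux j x t)) has_integral
      ux j b t * cnj (u j b t) - ux j a t * cnj (u j a t)) {a..b}"
    by (rule fundamental_theorem_of_calculus)
      (use ab t in \<open>auto intro!: has_vector_derivative_mult_cnj deriv_u_x deriv_ux_x\<close>)
  then have "integral {a..b} (\<lambda>x. uxx j x t * cnj (u j x t) + ux j x t * cnj (ux j x t)) = 0"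
    using u_periodic[OF t] ux_periodic[OF t] by (simp add: integral_unique)
  moreover have "integral {a..b} (\<lambda>x. uxx j x t * cnj (u j x t) + ux j x t * cnj (ux j x t)) =
      integral {a..b} (\<lambda>x. uxx j x t * cnj (u j x t)) + integral {a..b} (\<lambda>x. ux j x t * cnj (ux j x t))"
    by (intro integral_add integrable_continuous_real slice_continuity[OF t] continuous_intros)
  moreover have "integral {a..b} (\<lambda>x. ux j x t * cnj (ux j x t)) =
      of_real (integral {a..b} (\<lambda>x. (cmod (ux j x t))\<^sup>2))"
    unfolding complex_norm_square[symmetric]
    by (intro henstock_integral_complex_of_real integrable_continuous_real slice_continuity[OF t]
        continuous_intros)
  ultimately show ?thesis by (simp add: eq_neg_iff_add_eq_0)
qed

lemma energy_density_integrable: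
  assumes t: "t \<in> {0..T}"
  shows "(\<lambda>x. (cmod (ux j x t))\<^sup>2) integrable_on {a..b}"
    and "(\<lambda>x. potential j x t * (cmod (u j x t))\<^sup>2) integrable_on {a..b}"
  unfolding potential_def
  by (intro integrable_continuous_real slice_continuity[OF t] continuous_intros)+

lemma integral_energy_density:
  assumes t: "t \<in> {0..T}"
  shows "integral {a..b} (\<lambda>x. (\<Sum>j\<in>UNIV. 1/2 * (\<beta> j * (cmod (ux j x t))\<^sup>2))
      - 1/4 * (\<Sum>j\<in>UNIV. potential j x t * (cmod (u j x t))\<^sup>2)) =
    (\<Sum>j\<in>UNIV. 1/2 * (\<beta> j * integral {a..b} (\<lambda>x. (cmod (ux j x t))\<^sup>2))
      - 1/4 * integral {a..b} (\<lambda>x. potential j x t * (cmod (u j x t))\<^sup>2))"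
proof (rule integral_unique)
  show "((\<lambda>x. (\<Sum>j\<in>UNIV. 1/2 * (\<beta> j * (cmod (ux j x t))\<^sup>2))
      - 1/4 * (\<Sum>j\<in>UNIV. potential j x t * (cmod (u j x t))\<^sup>2)) has_integral
    (\<Sum>j\<in>UNIV. 1/2 * (\<beta> j * integral {a..b} (\<lambda>x. (cmod (ux j x t))\<^sup>2))
      - 1/4 * integral {a..b} (\<lambda>x. potential j x t * (cmod (u j x t))\<^sup>2))) {a..b}"
    unfolding sum_distrib_left sum_subtractf[symmetric]
    by (intro has_integral_sum has_integral_diff has_integral_mult_right integrable_integral
        energy_density_integrable[OF t]) simp
qed

lemma sum_integral_energy_eq:
  assumes t: "t \<in> {0..T}"
  shows "1/2 * (\<Sum>j\<in>UNIV. integral {a..b} (\<lambda>x. \<beta> j * (cmod (ux j x t))\<^sup>2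
      - 1/2 * (\<Sum>k\<in>UNIV. \<gamma> j k * (cmod (u k x t))\<^sup>2 * (cmod (u j x t))\<^sup>2))) =
    integral {a..b} (\<lambda>x. (\<Sum>j\<in>UNIV. 1/2 * (\<beta> j * (cmod (ux j x t))\<^sup>2))
      - 1/4 * (\<Sum>j\<in>UNIV. potential j x t * (cmod (u j x t))\<^sup>2))"
proof -
  have "integral {a..b} (\<lambda>x. \<beta> j * (cmod (ux j x t))\<^sup>2
      - 1/2 * (\<Sum>k\<in>UNIV. \<gamma> j k * (cmod (u k x t))\<^sup>2 * (cmod (u j x t))\<^sup>2)) =
    \<beta> j * integral {a..b} (\<lambda>x. (cmod (ux j x t))\<^sup>2)
      - 1/2 * integral {a..b} (\<lambda>x. potential j x t * (cmod (u j x t))\<^sup>2)" for j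
    unfolding sum_distrib_right[symmetric] potential_def[symmetric]
    by (intro integral_unique has_integral_diff has_integral_mult_right integrable_integral
        energy_density_integrable[OF t])
  then show ?thesis
    by (simp only: integral_energy_density[OF t]) (simp add: sum_distrib_left right_diff_distrib)
qed

text \<open>Together with the preceding lemma this makes the two expressions for the energy equal; in
  particular the complex one has real values.\<close>

lemma complex_energy_eq:
  assumes t: "t \<in> {0..T}"
  shows "- (1/2) * (\<Sum>j\<in>UNIV. integral {a..b} (\<lambda>x. of_real (\<beta> j) * uxx j x t * cnj (u j x t)))
      - (1/4) * (\<Sum>j\<in>UNIV. integral {a..b} (\<lambda>x. of_real (potential j x t) * u j x t * cnj (u j x t))) =
    of_real (integral {a..b} (\<lambda>x. (\<Sum>j\<in>UNIV. 1/2 * (\<beta> j * (cmod (ux j x t))\<^sup>2))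
      - 1/4 * (\<Sum>j\<in>UNIV. potential j x t * (cmod (u j x t))\<^sup>2)))"
proof -
  have "integral {a..b} (\<lambda>x. of_real (\<beta> j) * uxx j x t * cnj (u j x t)) =
      - of_real (\<beta> j * integral {a..b} (\<lambda>x. (cmod (ux j x t))\<^sup>2))" for j
    by (simp add: mult.assoc integral_uxx_cnj_u[OF t])
  moreover have "integral {a..b} (\<lambda>x. of_real (potential j x t) * u j x t * cnj (u j x t)) =
      of_real (integral {a..b} (\<lambda>x. potential j x t * (cmod (u j x t))\<^sup>2))" for j
    using henstock_integral_complex_of_real[OF energy_density_integrable(2)[OF t], of j]
    by (simp only: mult.assoc complex_norm_square[symmetric] of_real_mult)
  ultimately show ?thesis
    by (simp only: integral_energy_density[OF t]) (simp add: sum_subtractf sum_negf sum_distrib_left)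
qed

end

section \<open>Components of vector-valued solutions\<close>

lemma has_vector_derivative_vec_nth:
  assumes "(f has_vector_derivative f') (at x within S)"
  shows "((\<lambda>y. f y $ j) has_vector_derivative f' $ j) (at x within S)"
  by (rule bounded_linear.has_vector_derivative[OF bounded_linear_vec_nth assms])

lemma regularD:
  assumes "regular a b T f" and "x \<in> {a..b}" "t \<in> {0..T}"
  shows "((\<lambda>y. f y t) has_vector_derivative partial_x a b f x t) (at x within {a..b})"
    and "((\<lambda>y. partial_x a b f y t) has_vector_derivative partial_xx a b f x t) (at x within {a..b})"
    and "((\<lambda>s. f x s) has_vector_derivative partial_t T f x t) (at t within {0..T})"
    and "((\<lambda>s. partial_x a b f x s) has_vector_derivative partial_t T (partial_x a b f) x t)
      (at t within {0..T})"
proof -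
  have "(\<lambda>y. f y t) differentiable (at x within {a..b})"
    "(\<lambda>y. partial_x a b f y t) differentiable (at x within {a..b})"
    "(\<lambda>s. f x s) differentiable (at t within {0..T})"
    "(\<lambda>s. partial_x a b f x s) differentiable (at t within {0..T})"
    using assms unfolding regular_def by blast+
  then show "((\<lambda>y. f y t) has_vector_derivative partial_x a b f x t) (at x within {a..b})"
    "((\<lambda>y. partial_x a b f y t) has_vector_derivative partial_xx a b f x t) (at x within {a..b})"
    "((\<lambda>s. f x s) has_vector_derivative partial_t T f x t) (at t within {0..T})"
    "((\<lambda>s. partial_x a b f x s) has_vector_derivative partial_t T (partial_x a b f) x t)
      (at t within {0..T})"
    unfolding vector_derivative_works partial_t_def partial_x_def by blast+
qed

lemma joint_continuous_on_vec_nth: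
  fixes f :: "real \<Rightarrow> real \<Rightarrow> complex^'n"
  assumes "continuous_on A (\<lambda>(x, t). f x t)"
  shows "continuous_on A (\<lambda>(x, t). f x t $ j)"
  using bounded_linear.continuous_on[OF bounded_linear_vec_nth assms] by (simp add: split_def)

lemma manakov_components_of_solution:
  fixes \<psi> :: "real \<Rightarrow> real \<Rightarrow> complex^'n::finite"
  assumes "a < b" "0 < T" "transpose \<gamma> = \<gamma>"
    and reg: "regular a b T \<psi>" and per: "periodic_bc a b T \<psi>" and eqn: "manakov a b T \<beta> \<gamma> \<psi>"
  shows "manakov_components a b T (\<lambda>j. \<beta> $ j) (\<lambda>j k. \<gamma> $ j $ k)
    (\<lambda>j x t. \<psi> x t $ j) (\<lambda>j x t. partial_x a b \<psi> x t $ j) (\<lambda>j x t. partial_xx a b \<psi> x t $ j)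
    (\<lambda>j x t. partial_t T \<psi> x t $ j) (\<lambda>j x t. partial_t T (partial_x a b \<psi>) x t $ j)"
proof
  show "\<gamma> $ j $ k = \<gamma> $ k $ j" for j k
    using assms(3) by (metis transpose_def vec_lambda_beta)
  fix j
  show "continuous_on ({a..b} \<times> {0..T}) (\<lambda>(x, t). \<psi> x t $ j)"
    "continuous_on ({a..b} \<times> {0..T}) (\<lambda>(x, t). partial_x a b \<psi> x t $ j)"
    "continuous_on ({a..b} \<times> {0..T}) (\<lambda>(x, t). partial_xx a b \<psi> x t $ j)"
    "continuous_on ({a..b} \<times> {0..T}) (\<lambda>(x, t). partial_t T \<psi> x t $ j)"
    "continuous_on ({a..b} \<times> {0..T}) (\<lambda>(x, t). partial_t T (partial_x a b \<psi>) x t $ j)"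
    by (rule joint_continuous_on_vec_nth, use reg in \<open>simp add: regular_def\<close>)+
  fix t assume t: "t \<in> {0..T}"
  show "\<psi> a t $ j = \<psi> b t $ j" "partial_x a b \<psi> a t $ j = partial_x a b \<psi> b t $ j"
    using per t by (simp_all add: periodic_bc_def)
  fix x assume x: "x \<in> {a..b}"
  show "((\<lambda>y. \<psi> y t $ j) has_vector_derivative partial_x a b \<psi> x t $ j) (at x within {a..b})"
    "((\<lambda>y. partial_x a b \<psi> y t $ j) has_vector_derivative partial_xx a b \<psi> x t $ j)
      (at x within {a..b})"
    "((\<lambda>s. \<psi> x s $ j) has_vector_derivative partial_t T \<psi> x t $ j) (at t within {0..T})"
    "((\<lambda>s. partial_x a b \<psi> x s $ j) has_vector_derivative partial_t T (partial_x a b \<psi>) x t $ j)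
      (at t within {0..T})"
    by (intro has_vector_derivative_vec_nth regularD[OF reg x t])+
  show "\<i> * partial_t T \<psi> x t $ j = - of_real (\<beta> $ j) * partial_xx a b \<psi> x t $ j
      - (\<Sum>k\<in>UNIV. of_real (\<gamma> $ j $ k * (cmod (\<psi> x t $ k))\<^sup>2) * \<psi> x t $ j)"
    using eqn x t unfolding manakov_def by blast
qed (fact assms)+

lemma partial_x_component:
  fixes \<psi> :: "real \<Rightarrow> real \<Rightarrow> complex^'n::finite"
  assumes "a < b" and reg: "regular a b T \<psi>" and x: "x \<in> {a..b}" and t: "t \<in> {0..T}"
  shows "partial_x a b (\<lambda>y s. \<psi> y s $ j) x t = partial_x a b \<psi> x t $ j"
    and "partial_x a b (\<lambda>y s. cnj (\<psi> y s $ j)) x t = cnj (partial_x a b \<psi> x t $ j)"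
proof -
  have deriv: "((\<lambda>y. \<psi> y t $ j) has_vector_derivative partial_x a b \<psi> x t $ j) (at x within {a..b})"
    by (rule has_vector_derivative_vec_nth[OF regularD(1)[OF reg x t]])
  show "partial_x a b (\<lambda>y s. \<psi> y s $ j) x t = partial_x a b \<psi> x t $ j"
    unfolding partial_x_def[of a b "\<lambda>y s. \<psi> y s $ j"]
    by (rule vector_derivative_within_closed_interval[OF \<open>a < b\<close> x deriv])
  show "partial_x a b (\<lambda>y s. cnj (\<psi> y s $ j)) x t = cnj (partial_x a b \<psi> x t $ j)"
    unfolding partial_x_def[of a b "\<lambda>y s. cnj (\<psi> y s $ j)"]
    by (rule vector_derivative_within_closed_interval[OF \<open>a < b\<close> x
          bounded_linear.has_vector_derivative[OF bounded_linear_cnj deriv]])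
qed

lemma complexify_diag_mult_vec_nth:
  fixes v :: "complex^'n::finite"
  shows "(map_matrix of_real (diag \<beta>) *v v) $ j = of_real (\<beta> $ j) * v $ j"
  by (simp add: matrix_vector_mult_def map_matrix_def diag_def
      if_distrib[where f = of_real] if_distrib[where f = "\<lambda>c. c * y" for y] cong: if_cong)

lemma constant_on_cong:
  assumes "f constant_on S" and "\<And>x. x \<in> S \<Longrightarrow> g x = h (f x)"
  shows "g constant_on S"
  using assms unfolding constant_on_def by metis

theorem theorem1:
  fixes a b T :: real
    and \<beta> :: "real^'n::finite"
    and \<gamma> :: "real^'n^'n"
    and \<psi> :: "real \<Rightarrow> real \<Rightarrow> complex^'n"
    and \<psi>\<^sub>0 :: "real \<Rightarrow> complex^'n"
  assumes "a < b" and "0 < T"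
    and "transpose \<gamma> = \<gamma>"
    and "regular a b T \<psi>"
    and "periodic_bc a b T \<psi>"
    and "manakov a b T \<beta> \<gamma> \<psi>"
    and "\<forall>x\<in>{a..b}. \<psi> x 0 = \<psi>\<^sub>0 x"
  shows "(\<forall>j. mass a b \<psi> j constant_on {0..T}) \<and>
    total_mass a b \<psi> constant_on {0..T} \<and>
    momentum a b \<psi> constant_on {0..T} \<and>
    (\<forall>t\<in>{0..T}. complex_of_real (momentum a b \<psi> t) =
       1 / (2 * \<i>) * (\<Sum>j\<in>UNIV. integral {a..b} (\<lambda>x.
          cnj (\<psi> x t $ j) * partial_x a b (\<lambda>y s. \<psi> y s $ j) x t
          - \<psi> x t $ j * partial_x a b (\<lambda>y s. cnj (\<psi> y s $ j)) x t))) \<and>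
    energy a b \<beta> \<gamma> \<psi> constant_on {0..T} \<and>
    (\<forall>t\<in>{0..T}. energy a b \<beta> \<gamma> \<psi> t = complex_of_real (
       1 / 2 * (\<Sum>j\<in>UNIV. integral {a..b} (\<lambda>x.
          \<beta> $ j * (cmod (partial_x a b (\<lambda>y s. \<psi> y s $ j) x t))\<^sup>2
          - 1 / 2 * (\<Sum>k\<in>UNIV. \<gamma> $ j $ k * (cmod (\<psi> x t $ k))\<^sup>2 * (cmod (\<psi> x t $ j))\<^sup>2)))))"
proof (intro conjI allI ballI)
  interpret manakov_components a b T "\<lambda>j. \<beta> $ j" "\<lambda>j k. \<gamma> $ j $ k"
    "\<lambda>j x t. \<psi> x t $ j" "\<lambda>j x t. partial_x a b \<psi> x t $ j" "\<lambda>j x t. partial_xx a b \<psi> x t $ j"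
    "\<lambda>j x t. partial_t T \<psi> x t $ j" "\<lambda>j x t. partial_t T (partial_x a b \<psi>) x t $ j"
    by (rule manakov_components_of_solution) (fact assms)+
  have component: "partial_x a b (\<lambda>y s. \<psi> y s $ j) x t = partial_x a b \<psi> x t $ j"
    "partial_x a b (\<lambda>y s. cnj (\<psi> y s $ j)) x t = cnj (partial_x a b \<psi> x t $ j)"
    if "t \<in> {0..T}" "x \<in> {a..b}" for x t j
    by (rule partial_x_component[OF assms(1,4) that(2,1)])+
  define P where "P t = integral {a..b} (\<lambda>x. \<Sum>j\<in>UNIV. Im (partial_x a b \<psi> x t $ j * cnj (\<psi> x t $ j)))"
    for t
  define H where "H t = integral {a..b} (\<lambda>x.
      (\<Sum>j\<in>UNIV. 1/2 * (\<beta> $ j * (cmod (partial_x a b \<psi> x t $ j))\<^sup>2))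
      - 1/4 * (\<Sum>j\<in>UNIV. potential j x t * (cmod (\<psi> x t $ j))\<^sup>2))" for t
  have P: "momentum a b \<psi> t = P t" if "t \<in> {0..T}" for t
    unfolding momentum_def L2_inner_def P_def by (rule Im_sum_integral_ux_cnj_u[OF that])
  have H: "energy a b \<beta> \<gamma> \<psi> t = of_real (H t)" if "t \<in> {0..T}" for t
  proof -
    have V: "complex_vec (\<gamma> *v abs_square (\<psi> x t)) $ j = of_real (potential j x t)" for x j
      by (simp add: complex_vec_def matrix_vector_mult_def abs_square_def potential_def)
    then show ?thesis
      unfolding energy_def L2_inner_def H_def
      using complex_energy_eq[OF that] by (simp only: complexify_diag_mult_vec_nth vector_mult_component V)
  qed
  show mass: "mass a b \<psi> j constant_on {0..T}" for j
    using mass_conserved[of j] by (rule constant_on_cong) (simp add: mass_def)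
  obtain m where "\<And>j t. t \<in> {0..T} \<Longrightarrow> mass a b \<psi> j t = m j"
    using mass unfolding constant_on_def by metis
  then show "total_mass a b \<psi> constant_on {0..T}"
    unfolding constant_on_def total_mass_def by (intro exI[of _ "\<Sum>j\<in>UNIV. m j"]) simp
  show "momentum a b \<psi> constant_on {0..T}"
    using momentum_conserved by (rule constant_on_cong) (simp add: P P_def)
  show "energy a b \<beta> \<gamma> \<psi> constant_on {0..T}"
    using energy_conserved by (rule constant_on_cong[where h = of_real]) (simp only: H H_def)
  fix t assume t: "t \<in> {0..T}"
  show "complex_of_real (momentum a b \<psi> t) = 1 / (2 * \<i>) * (\<Sum>j\<in>UNIV. integral {a..b} (\<lambda>x.
      cnj (\<psi> x t $ j) * partial_x a b (\<lambda>y s. \<psi> y s $ j) x t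
      - \<psi> x t $ j * partial_x a b (\<lambda>y s. cnj (\<psi> y s $ j)) x t))"
    unfolding P[OF t] P_def sum_integral_antisymmetrized_eq[OF t, symmetric]
    by (intro arg_cong2[where f = "(*)"] sum.cong integral_cong refl) (simp only: component[OF t])
  show "energy a b \<beta> \<gamma> \<psi> t = complex_of_real (1 / 2 * (\<Sum>j\<in>UNIV. integral {a..b} (\<lambda>x.
      \<beta> $ j * (cmod (partial_x a b (\<lambda>y s. \<psi> y s $ j) x t))\<^sup>2
      - 1 / 2 * (\<Sum>k\<in>UNIV. \<gamma> $ j $ k * (cmod (\<psi> x t $ k))\<^sup>2 * (cmod (\<psi> x t $ j))\<^sup>2))))"
    unfolding H[OF t] H_def sum_integral_energy_eq[OF t, symmetric]
    by (intro arg_cong[where f = of_real] arg_cong2[where f = "(*)"] sum.cong integral_cong refl)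
      (simp only: component[OF t])
qed

end
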